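(* Let $r\in\mathbb{R}$ be a Liouville number and let $(p_m)_{m\ge 1}$, $(q_m)_{m\ge 1}$ be sequences of integers with $p_m\ge 2$, $q_m\ge 1$, such that $0<|rp_m-q_m|<p_m^{-m}$ for all $m\ge 1$ and $p_m^{-m}<|rp_{m-1}-q_{m-1}|$ for all $m\ge 2$. Let $h:\mathbb{T}^3\to\mathbb{R}^3$ be the vector field $$h(z)=\Bigl(r,\ 1,\ \sum_{m=1}^{\infty} m\,p_m^{-m+1}\cos\bigl(2\pi(z_1p_m-z_2q_m)\bigr)\Bigr),$$ and let $x=(x_1,x_2,x_3)$ be the solution of $\dot x=h(x)$, $x(0)=0$. Then the function $t\mapsto x_3(t)$ is unbounded on $[0,\infty)$. Consequently, the rotation vector of this initial value problem does not exist in the strong sense.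
   Context: $\mathbb{T}^3=\mathbb{R}^3/\mathbb{Z}^3$. A real number $r$ is called a Liouville number here if for each integer $n\ge 1$ there exist integers $p\ge 2$ and $q\ge 1$ with $0<|rp-q|<p^{-n}$. The vector field $h$ is identified with its $\mathbb{Z}^3$-periodic lift to $\mathbb{R}^3$, and the solution $x:\mathbb{R}\to\mathbb{R}^3$ of the initial value problem is taken in $\mathbb{R}^3$ (i.e. it is a lift of the trajectory on the torus). For a lifted trajectory $X:\mathbb{R}\to\mathbb{R}^3$, the rotation vector exists in the strong sense if the limit $\rho:=\lim_{t\to\infty}\frac{X(t)-X(0)}{t}$ exists in $\mathbb{R}^3$ and moreover $\sup_{t\ge 0}\|X(t)-X(0)-\rho t\|<\infty$. *)

theory Defs
  imports "HOL-Analysis.Analysis"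
begin

definition liouville_number :: "real \<Rightarrow> bool" where
  "liouville_number r \<longleftrightarrow>
     (\<forall>n::nat. n \<ge> 1 \<longrightarrow>
        (\<exists>p q::int. p \<ge> 2 \<and> q \<ge> 1 \<and>
           0 < \<bar>r * of_int p - of_int q\<bar> \<and>
           \<bar>r * of_int p - of_int q\<bar> < (of_int p :: real) powi (- int n)))"

definition mode :: "(nat \<Rightarrow> int) \<Rightarrow> (nat \<Rightarrow> int) \<Rightarrow> nat \<Rightarrow> real ^ 3 \<Rightarrow> real" where
  "mode p q m z =
     real m * (of_int (p m) powi (1 - int m)) *
     cos (2 * pi * (z $ 1 * of_int (p m) - z $ 2 * of_int (q m)))"

text \<open>The vector field on the torus, given by its lift to the universal cover.  The series starts
  at index 1, whence the shift by \<open>Suc\<close>; for \<open>p m \<ge> 2\<close> it converges absolutely and uniformly.\<close>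

definition h :: "real \<Rightarrow> (nat \<Rightarrow> int) \<Rightarrow> (nat \<Rightarrow> int) \<Rightarrow> real ^ 3 \<Rightarrow> real ^ 3" where
  "h r p q z = vector [r, 1, \<Sum>n. mode p q (Suc n) z]"

lemma mode_periodic:
  assumes "\<And>i. k $ i \<in> \<int>"
  shows "mode p q m (z + k) = mode p q m z"
proof -
  obtain a b where ab: "k $ 1 = of_int a" "k $ 2 = of_int b"
    using assms by (meson Ints_cases)
  have "2 * pi * ((z + k) $ 1 * of_int (p m) - (z + k) $ 2 * of_int (q m)) =
        2 * pi * (z $ 1 * of_int (p m) - z $ 2 * of_int (q m)) +
        2 * pi * of_int (a * p m - b * q m)"
    by (simp add: ab algebra_simps)
  then show ?thesis
    unfolding mode_def by (simp only: cos_add cos_int_2pin sin_int_2pin) simp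
qed

text \<open>Hence \<open>h\<close> is well defined on the torus.\<close>

lemma h_periodic:
  assumes "\<And>i. k $ i \<in> \<int>"
  shows "h r p q (z + k) = h r p q z"
  by (simp add: h_def mode_periodic[OF assms])

definition solves_ivp :: "(real ^ 3 \<Rightarrow> real ^ 3) \<Rightarrow> real ^ 3 \<Rightarrow> (real \<Rightarrow> real ^ 3) \<Rightarrow> bool" where
  "solves_ivp f x0 x \<longleftrightarrow>
     x 0 = x0 \<and> (\<forall>t. (x has_vector_derivative f (x t)) (at t))"

text \<open>Finiteness of the supremum is expressed by \<open>bdd_above\<close>, as \<open>Sup\<close> on the reals is
  unspecified for unbounded sets.\<close>

definition strong_rotation_vector_exists :: "(real \<Rightarrow> real ^ 3) \<Rightarrow> bool" where
  "strong_rotation_vector_exists X \<longleftrightarrow>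
     (\<exists>\<rho>. ((\<lambda>t. (X t - X 0) /\<^sub>R t) \<longlongrightarrow> \<rho>) at_top \<and>
          bdd_above ((\<lambda>t. norm (X t - X 0 - t *\<^sub>R \<rho>)) ` {0..}))"

end

theory Submission imports Defs begin

text \<open>
  Along the solution, \<open>x\<^sub>3\<close> has derivative \<open>\<Sum> a\<^sub>n cos (\<omega>\<^sub>n t)\<close> with \<open>a\<^sub>n \<ge> 0\<close>. Integrating
  against \<open>(T - t) cos (\<omega>\<^sub>k t)\<close> on \<open>[0, T]\<close> isolates the \<open>k\<close>-th mode: the Fejer weight \<open>T - t\<close>
  makes the integral of every other mode nonnegative, so the result is at least \<open>a\<^sub>k T\<^sup>2 / 4\<close>.
  If \<open>\<bar>x\<^sub>3 t - \<rho> t\<bar> \<le> B\<close>, integration by parts bounds the same quantity by \<open>B \<bar>\<omega>\<^sub>k\<bar> T\<^sup>2 + O(T)\<close>.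
  Hence \<open>a\<^sub>k \<le> 4 B \<bar>\<omega>\<^sub>k\<bar>\<close> for all \<open>k\<close>, whereas \<open>a\<^sub>k / \<bar>\<omega>\<^sub>k\<bar>\<close> is unbounded.
\<close>

section \<open>Integrals against the Fejer weight \<open>T - t\<close>\<close>

lemma fejer_cos_has_integral:
  fixes w T :: real
  assumes "w \<noteq> 0" "T \<ge> 0"
  shows "((\<lambda>t. (T - t) * cos (w * t)) has_integral (1 - cos (w * T)) / w\<^sup>2) {0..T}"
proof -
  let ?G = "\<lambda>t. (T - t) * sin (w * t) / w - cos (w * t) / w\<^sup>2"
  have "(?G has_vector_derivative (T - t) * cos (w * t)) (at t within {0..T})" for t
    unfolding has_real_derivative_iff_has_vector_derivative[symmetric]
    using assms(1) by (auto intro!: derivative_eq_intros simp: field_simps power2_eq_square)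
  then have "((\<lambda>t. (T - t) * cos (w * t)) has_integral ?G T - ?G 0) {0..T}"
    using assms(2) by (intro fundamental_theorem_of_calculus) auto
  then show ?thesis
    by (simp add: diff_divide_distrib)
qed

lemma fejer_has_integral:
  fixes T :: real
  assumes "T \<ge> 0"
  shows "((\<lambda>t. T - t) has_integral T\<^sup>2 / 2) {0..T}"
proof -
  let ?G = "\<lambda>t. T * t - t\<^sup>2 / 2"
  have "(?G has_vector_derivative T - t) (at t within {0..T})" for t
    unfolding has_real_derivative_iff_has_vector_derivative[symmetric]
    by (auto intro!: derivative_eq_intros)
  then have "((\<lambda>t. T - t) has_integral ?G T - ?G 0) {0..T}"
    using assms by (intro fundamental_theorem_of_calculus) auto
  then show ?thesis
    by (simp add: power2_eq_square)
qed

text \<open>The closed forms \<open>(1 - cos (w * T)) / w\<^sup>2\<close> and, at frequency zero,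
  \<open>T\<^sup>2 / 2\<close> are nonnegative. This sign, valid at every frequency, later lets all
  modes but one be dropped.\<close>

lemma fejer_cos_integral_nonneg:
  fixes w T :: real
  assumes "T \<ge> 0"
  shows "0 \<le> integral {0..T} (\<lambda>t. (T - t) * cos (w * t))"
proof (cases "w = 0")
  case True
  then show ?thesis
    using fejer_has_integral[OF assms] by (simp add: integral_unique)
next
  case False
  then show ?thesis
    using fejer_cos_has_integral[OF False assms] by (simp add: integral_unique)
qed

text \<open>Product-to-sum formula under the integral. For \<open>v = w\<close> the first summand
  has frequency zero and equals \<open>T\<^sup>2 / 2\<close>, which is the source of the constant
  \<open>T\<^sup>2 / 4\<close> below.\<close>

lemma fejer_cos_cos_integral:
  fixes v w T :: real
  assumes "T \<ge> 0"
  shows "integral {0..T} (\<lambda>t. cos (v * t) * ((T - t) * cos (w * t))) =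
    (integral {0..T} (\<lambda>t. (T - t) * cos ((v - w) * t)) +
     integral {0..T} (\<lambda>t. (T - t) * cos ((v + w) * t))) / 2"
proof -
  have "integral {0..T} (\<lambda>t. cos (v * t) * ((T - t) * cos (w * t))) =
    integral {0..T} (\<lambda>t. ((T - t) * cos ((v - w) * t) + (T - t) * cos ((v + w) * t)) / 2)"
    by (intro integral_cong) (simp add: cos_diff cos_add algebra_simps)
  also have "\<dots> = integral {0..T}
      (\<lambda>t. (T - t) * cos ((v - w) * t) + (T - t) * cos ((v + w) * t)) / 2"
    by simp
  also have "integral {0..T} (\<lambda>t. (T - t) * cos ((v - w) * t) + (T - t) * cos ((v + w) * t)) =
    integral {0..T} (\<lambda>t. (T - t) * cos ((v - w) * t)) +
    integral {0..T} (\<lambda>t. (T - t) * cos ((v + w) * t))"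
    by (intro Henstock_Kurzweil_Integration.integral_add integrable_continuous_real)
       (auto intro!: continuous_intros)
  finally show ?thesis .
qed

section \<open>Cosine series with nonnegative coefficients\<close>

text \<open>Uniform convergence permits termwise integration, and every term is nonnegative, so
  discarding all but the \<open>k\<close>-th can only decrease the sum. Coinciding frequencies
  merely add to it.\<close>

lemma fejer_cosine_series_lower_bound:
  fixes a w :: "nat \<Rightarrow> real" and T :: real and k :: nat
  assumes a: "\<And>n. a n \<ge> 0" and "summable a" and T: "T \<ge> 0"
  defines "g \<equiv> \<lambda>t. (T - t) * cos (w k * t)"
  shows "(\<lambda>t. (\<Sum>n. a n * cos (w n * t)) * g t) integrable_on {0..T}" (is ?int)
    and "a k * T\<^sup>2 / 4 \<le> integral {0..T} (\<lambda>t. (\<Sum>n. a n * cos (w n * t)) * g t)" (is ?le)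
proof -
  let ?S = "\<lambda>n t. (\<Sum>i<n. a i * cos (w i * t) * g t)"
  let ?f = "\<lambda>t. (\<Sum>n. a n * cos (w n * t)) * g t"
  have cont: "continuous_on {0..T} (\<lambda>t. a i * cos (w i * t) * g t)" for i
    unfolding g_def by (intro continuous_intros)
  have g_le: "\<bar>g t\<bar> \<le> T" if "t \<in> {0..T}" for t
    using that mult_mono[of "\<bar>T - t\<bar>" T "\<bar>cos (w k * t)\<bar>" 1]
    unfolding g_def by (simp add: abs_mult)
  \<comment> \<open>Summability of \<open>a\<close> makes \<open>a n * T\<close> a summable
    majorant, so limit and integral may be exchanged.\<close>
  have "uniform_limit {0..T} ?S (\<lambda>t. \<Sum>n. a n * cos (w n * t) * g t) sequentially"
  proof (rule Weierstrass_m_test)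
    fix n t assume "t \<in> {0..T}"
    then have "\<bar>cos (w n * t)\<bar> * \<bar>g t\<bar> \<le> 1 * T"
      using g_le by (intro mult_mono) auto
    then show "norm (a n * cos (w n * t) * g t) \<le> a n * T"
      using a[of n] by (simp add: abs_mult mult.assoc mult_left_mono)
  qed (intro summable_mult2 assms)
  moreover have "(\<Sum>n. a n * cos (w n * t) * g t) = ?f t" for t
  proof -
    have "summable (\<lambda>n. a n * cos (w n * t))"
    proof (rule summable_comparison_test'[OF \<open>summable a\<close>])
      show "norm (a n * cos (w n * t)) \<le> a n" for n
        using a[of n] by (simp add: abs_mult mult_left_le)
    qed
    then show ?thesis
      by (rule suminf_mult2[symmetric])
  qed
  ultimately have lim: "uniform_limit {0..T} ?S ?f sequentially"
    by simp
  have S_cont: "continuous_on {0..T} (?S n)" for n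
    by (intro continuous_on_sum cont)
  obtain I J where I: "\<And>n. (?S n has_integral I n) {0..T}" "(?f has_integral J) {0..T}"
      "(I \<longlongrightarrow> J) sequentially"
    using uniform_limit_integral[OF lim S_cont] by auto
  have term_ge: "integral {0..T} (\<lambda>t. a i * cos (w i * t) * g t) \<ge>
      (if i = k then a k * T\<^sup>2 / 4 else 0)" for i
  proof -
    have "integral {0..T} (\<lambda>t. a i * cos (w i * t) * g t) =
        a i * integral {0..T} (\<lambda>t. cos (w i * t) * ((T - t) * cos (w k * t)))"
      by (simp add: g_def mult.assoc)
    moreover have "integral {0..T} (\<lambda>t. cos (w i * t) * ((T - t) * cos (w k * t))) \<ge>
        (if i = k then T\<^sup>2 / 4 else 0)"
      using fejer_cos_integral_nonneg[OF T, of "w i - w k"]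
        fejer_cos_integral_nonneg[OF T, of "w i + w k"]
        integral_unique[OF fejer_has_integral[OF T]]
      unfolding fejer_cos_cos_integral[OF T] by auto
    ultimately show ?thesis
      using a[of i] mult_left_mono[of "if i = k then T\<^sup>2 / 4 else 0" _ "a i"] by auto
  qed
  have "I n \<ge> a k * T\<^sup>2 / 4" if "n > k" for n
  proof -
    have "I n = (\<Sum>i<n. integral {0..T} (\<lambda>t. a i * cos (w i * t) * g t))"
      using integral_unique[OF I(1)[of n]]
      by (subst integral_sum[symmetric]) (auto intro: integrable_continuous_real cont)
    also have "\<dots> \<ge> (\<Sum>i<n. if i = k then a k * T\<^sup>2 / 4 else 0)"
      by (intro sum_mono term_ge)
    finally show ?thesis
      using that by simp
  qed
  then have "J \<ge> a k * T\<^sup>2 / 4"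
    by (intro tendsto_lowerbound[OF I(3)] eventually_sequentiallyI[of "Suc k"]) auto
  then show ?int ?le
    using I(2) by (auto simp: integral_unique)
qed

text \<open>Integration by parts moves the derivative from \<open>f t - \<rho> * t\<close> to the
  weighted cosine, whose derivative is at most \<open>1 + \<bar>w k\<bar> * T\<close> in absolute
  value. Comparing the terms of order \<open>T\<^sup>2\<close> with the Fejer lower bound gives the
  claim as \<open>T\<close> tends to infinity.\<close>

lemma cosine_series_coefficient_bound:
  fixes a w :: "nat \<Rightarrow> real" and f :: "real \<Rightarrow> real"
  assumes a: "\<And>n. a n \<ge> 0" and "summable a" and wk: "w k \<noteq> 0"
    and f: "\<And>t. (f has_real_derivative (\<Sum>n. a n * cos (w n * t))) (at t)"
    and f0: "f 0 = 0"
    and B: "\<And>t. t \<ge> 0 \<Longrightarrow> \<bar>f t - \<rho> * t\<bar> \<le> B"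
  shows "a k \<le> 4 * B * \<bar>w k\<bar>"
proof -
  let ?d = "\<lambda>t. \<Sum>n. a n * cos (w n * t)"
  let ?F = "\<lambda>t. f t - \<rho> * t"
  have B0: "B \<ge> 0"
    using B[of 0] by simp
  \<comment> \<open>The parentheses collect what vanishes as \<open>T\<close> grows:
    \<open>B / T\<close> comes from differentiating \<open>T - t\<close>, the other term from the
    drift \<open>\<rho>\<close>.\<close>
  have bound: "a k / 4 \<le> B * \<bar>w k\<bar> + (B / T + 2 * \<bar>\<rho>\<bar> / (w k)\<^sup>2 / T\<^sup>2)" if "T > 0" for T
  proof -
    have T: "T \<ge> 0" using that by simp
    let ?g = "\<lambda>t. (T - t) * cos (w k * t)"
    let ?g' = "\<lambda>t. - cos (w k * t) - w k * (T - t) * sin (w k * t)"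
    have f_cont: "continuous_on {0..T} f"
      by (rule DERIV_continuous_on) (rule has_field_derivative_at_within[OF f])
    have Fg': "(\<lambda>t. ?F t * ?g' t) integrable_on {0..T}"
      by (intro integrable_continuous_real continuous_intros f_cont)
    have "((\<lambda>t. ?F t * ?g t) has_vector_derivative
        (?d t - \<rho>) * ?g t + ?F t * ?g' t) (at t within {0..T})" for t
      unfolding has_real_derivative_iff_has_vector_derivative[symmetric]
      by (rule derivative_eq_intros has_field_derivative_at_within[OF f] refl)+
        (simp add: algebra_simps)
    then have "((\<lambda>t. (?d t - \<rho>) * ?g t + ?F t * ?g' t) has_integral
        ?F T * ?g T - ?F 0 * ?g 0) {0..T}"
      by (intro fundamental_theorem_of_calculus T) auto
    \<comment> \<open>Both boundary terms vanish: the weight is zero at \<open>T\<close>, and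
      \<open>?F 0 = 0\<close>.\<close>
    then have FTC: "((\<lambda>t. (?d t - \<rho>) * ?g t + ?F t * ?g' t) has_integral 0) {0..T}"
      by (simp add: f0)
    note low = fejer_cosine_series_lower_bound[where w = w and k = k, OF a \<open>summable a\<close> T]
    note cos_int = fejer_cos_has_integral[OF wk T]
    have "((\<lambda>t. (?d t - \<rho>) * ?g t + ?F t * ?g' t) has_integral
        integral {0..T} (\<lambda>t. ?d t * ?g t) - \<rho> * ((1 - cos (w k * T)) / (w k)\<^sup>2) +
        integral {0..T} (\<lambda>t. ?F t * ?g' t)) {0..T}"
      \<comment> \<open>The instantiation expands only the factor \<open>?d t - \<rho>\<close>; the
        differences inside \<open>?F\<close> and \<open>?g'\<close> stay intact.\<close>
      unfolding left_diff_distrib[of "?d _" \<rho>]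
      by (intro has_integral_add has_integral_diff has_integral_mult_right
          integrable_integral low(1) cos_int Fg')
    from has_integral_unique[OF FTC this] have eq: "integral {0..T} (\<lambda>t. ?d t * ?g t) =
        \<rho> * ((1 - cos (w k * T)) / (w k)\<^sup>2) - integral {0..T} (\<lambda>t. ?F t * ?g' t)"
      by linarith
    have "\<bar>?F t * ?g' t\<bar> \<le> B * (1 + \<bar>w k\<bar> * T)" if "t \<in> {0..T}" for t
    proof -
      have "\<bar>w k * (T - t) * sin (w k * t)\<bar> \<le> \<bar>w k\<bar> * T * 1"
        unfolding abs_mult using that by (intro mult_mono) auto
      moreover have "\<bar>?g' t\<bar> \<le> \<bar>cos (w k * t)\<bar> + \<bar>w k * (T - t) * sin (w k * t)\<bar>"
        by arith
      ultimately have "\<bar>?g' t\<bar> \<le> 1 + \<bar>w k\<bar> * T"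
        using abs_cos_le_one[of "w k * t"] by linarith
      then show ?thesis
        unfolding abs_mult using B[of t] that B0 by (intro mult_mono) auto
    qed
    then have "norm (integral {0..T} (\<lambda>t. ?F t * ?g' t)) \<le> B * (1 + \<bar>w k\<bar> * T) * (T - 0)"
      using T by (intro integral_bound continuous_intros f_cont) auto
    \<comment> \<open>The drift contributes an amount bounded independently of
      \<open>T\<close>.\<close>
    moreover have "\<rho> * ((1 - cos (w k * T)) / (w k)\<^sup>2) \<le> \<bar>\<rho>\<bar> * (2 / (w k)\<^sup>2)"
    proof (rule mult_mono)
      have "1 - cos (w k * T) \<le> 2"
        using cos_ge_minus_one[of "w k * T"] by linarith
      then show "(1 - cos (w k * T)) / (w k)\<^sup>2 \<le> 2 / (w k)\<^sup>2"
        by (rule divide_right_mono) simp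
    qed auto
    ultimately have "a k * T\<^sup>2 / 4 \<le> \<bar>\<rho>\<bar> * (2 / (w k)\<^sup>2) + B * (1 + \<bar>w k\<bar> * T) * T"
      using low(2) eq unfolding real_norm_def diff_zero by linarith
    then have "a k / 4 \<le> (\<bar>\<rho>\<bar> * (2 / (w k)\<^sup>2) + B * (1 + \<bar>w k\<bar> * T) * T) / T\<^sup>2"
      using that by (simp add: pos_le_divide_eq)
    also have "\<dots> = B * \<bar>w k\<bar> + (B / T + 2 * \<bar>\<rho>\<bar> / (w k)\<^sup>2 / T\<^sup>2)"
      using that wk by (simp add: field_simps power2_eq_square)
    finally show ?thesis .
  qed
  have "((\<lambda>T. B * \<bar>w k\<bar> + (B / T + 2 * \<bar>\<rho>\<bar> / (w k)\<^sup>2 / T\<^sup>2)) \<longlongrightarrow> B * \<bar>w k\<bar> + (0 + 0)) at_top"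
    by (intro tendsto_intros tendsto_divide_0 filterlim_at_top_imp_at_infinity
        filterlim_pow_at_top filterlim_ident) auto
  then have "a k / 4 \<le> B * \<bar>w k\<bar> + (0 + 0)"
    by (rule tendsto_lowerbound)
      (rule eventually_mono[OF eventually_gt_at_top[of 0]], erule bound, simp)
  then show ?thesis
    by simp
qed

section \<open>The vector field \<open>h\<close> and its trajectory\<close>

text \<open>With \<open>m = Suc n\<close> the exponent \<open>1 - m\<close> is \<open>- n\<close>,
  so \<open>p m \<ge> 2\<close> yields the majorant \<open>(n + 1) / 2 ^ n\<close>, the termwise
  derivative of the geometric series at \<open>1/2\<close>.\<close>

lemma summable_mode_amplitudes:
  fixes p :: "nat \<Rightarrow> int"
  assumes "\<And>m. m \<ge> 1 \<Longrightarrow> p m \<ge> 2"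
  shows "summable (\<lambda>n. real (Suc n) * of_int (p (Suc n)) powi (1 - int (Suc n)))"
proof (rule summable_comparison_test')
  have "summable (\<lambda>n. of_nat (Suc n) * (1 :: real) * (1 / 2) ^ n)"
    using termdiff_converges[of "1/2 :: real" 1 "\<lambda>_. 1"]
    by (simp add: diffs_def summable_geometric)
  then show "summable (\<lambda>n. real (Suc n) * (1 / 2) ^ n)"
    by simp
next
  fix n :: nat
  have p: "real_of_int (p (Suc n)) \<ge> 2"
    using assms[of "Suc n"] by simp
  have "real_of_int (p (Suc n)) powi (1 - int (Suc n)) = (1 / of_int (p (Suc n))) ^ n"
    by (simp add: power_int_minus power_one_over inverse_eq_divide)
  also have "\<dots> \<le> (1 / 2) ^ n"
    using p by (intro power_mono) (auto simp: field_simps)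
  finally have "real_of_int (p (Suc n)) powi (1 - int (Suc n)) \<le> (1 / 2) ^ n" .
  then show "norm (real (Suc n) * of_int (p (Suc n)) powi (1 - int (Suc n)))
      \<le> real (Suc n) * (1 / 2) ^ n"
    using p by (simp add: abs_mult mult_left_mono)
qed

text \<open>The first two components of \<open>h\<close> are constant, which fixes the trajectory in
  the plane; the third depends only on these two coordinates, so its equation reduces to a
  quadrature.\<close>

lemma solves_ivp_h_components:
  assumes "solves_ivp (h r p q) 0 x"
  shows "x t $ 1 = r * t" and "x t $ 2 = t"
    and "((\<lambda>t. x t $ 3) has_real_derivative (\<Sum>n. mode p q (Suc n) (x t))) (at t)"
proof -
  have x0: "x 0 = 0" and deriv: "(x has_vector_derivative h r p q (x t)) (at t)" for t
    using assms by (auto simp: solves_ivp_def)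
  have comp: "((\<lambda>t. x t $ i) has_real_derivative h r p q (x t) $ i) (at t)" for i t
    unfolding has_real_derivative_iff_has_vector_derivative
    by (rule bounded_linear.has_vector_derivative[OF bounded_linear_vec_nth deriv])
  have linear: "x t $ i = c * t" if "\<And>z. h r p q z $ i = c" for i c
  proof -
    have "((\<lambda>t. x t $ i - c * t) has_real_derivative 0) (at s)" for s
      by (rule derivative_eq_intros comp refl)+ (simp add: that)
    from DERIV_isconst_all[OF allI[OF this], of t 0] show ?thesis
      by (simp add: x0)
  qed
  show "x t $ 1 = r * t" "x t $ 2 = t"
    using linear[of 1 r] linear[of 2 1] by (auto simp: h_def)
  show "((\<lambda>t. x t $ 3) has_real_derivative (\<Sum>n. mode p q (Suc n) (x t))) (at t)"
    using comp[of 3 t] by (simp add: h_def)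
qed

text \<open>The amplitude \<open>m * p powi (1 - m)\<close> divided by a frequency below
  \<open>2 * pi * p powi (- m)\<close> exceeds \<open>m * p / (2 * pi)\<close>, which is unbounded
  in \<open>m\<close>. The free slope \<open>\<rho>\<close> serves both final claims.\<close>

lemma third_component_drift_unbounded:
  fixes r :: real and p q :: "nat \<Rightarrow> int" and x :: "real \<Rightarrow> real ^ 3"
  assumes p: "\<And>m. m \<ge> 1 \<Longrightarrow> p m \<ge> 2"
    and pos: "\<And>m. m \<ge> 1 \<Longrightarrow> 0 < \<bar>r * of_int (p m) - of_int (q m)\<bar>"
    and small: "\<And>m. m \<ge> 1 \<Longrightarrow>
           \<bar>r * of_int (p m) - of_int (q m)\<bar> < of_int (p m) powi (- int m)"
    and x: "solves_ivp (h r p q) 0 x"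
  shows "\<exists>t\<ge>0. \<bar>x t $ 3 - \<rho> * t\<bar> > B"
proof (rule ccontr)
  assume "\<not> ?thesis"
  then have bound: "\<bar>x t $ 3 - \<rho> * t\<bar> \<le> B" if "t \<ge> 0" for t
    using that by (meson not_le)
  define a where "a n = real (Suc n) * of_int (p (Suc n)) powi (1 - int (Suc n))" for n
  define w where "w n = 2 * pi * (r * of_int (p (Suc n)) - of_int (q (Suc n)))" for n
  have p2: "real_of_int (p (Suc n)) \<ge> 2" for n
    using p[of "Suc n"] by simp
  have B0: "B \<ge> 0"
    using bound[of 0] by linarith
  have "mode p q (Suc n) (x t) = a n * cos (w n * t)" for n t
    by (simp add: mode_def a_def w_def solves_ivp_h_components[OF x] algebra_simps)
  then have deriv: "((\<lambda>t. x t $ 3) has_real_derivative (\<Sum>n. a n * cos (w n * t))) (at t)" for t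
    using solves_ivp_h_components(3)[OF x, of t] by simp
  have "real (Suc k) \<le> 8 * pi * B" for k
  proof -
    let ?P = "real_of_int (p (Suc k))"
    have "a k \<le> 4 * B * \<bar>w k\<bar>"
    proof (rule cosine_series_coefficient_bound[OF _ _ _ deriv _ bound])
      show "a n \<ge> 0" for n
        using p2[of n] by (simp add: a_def)
      show "summable a"
        unfolding a_def using summable_mode_amplitudes[OF p] by simp
      show "w k \<noteq> 0"
        using pos[of "Suc k"] by (simp add: w_def)
      show "x 0 $ 3 = 0"
        using x by (simp add: solves_ivp_def)
    qed
    also have "\<dots> \<le> 4 * B * (2 * pi * ?P powi (- int (Suc k)))"
      using small[of "Suc k"] B0 by (auto simp: w_def abs_mult intro!: mult_left_mono)
    also have "\<dots> = 8 * pi * B * ?P powi (- int (Suc k))"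
      by simp
    \<comment> \<open>Splitting off one factor \<open>?P\<close> leaves the same positive power on
      both sides, which then cancels.\<close>
    also have "a k = real (Suc k) * ?P * ?P powi (- int (Suc k))"
      using p2[of k] power_int_add[of ?P 1 "- int (Suc k)"] by (simp add: a_def)
    finally have "real (Suc k) * ?P \<le> 8 * pi * B"
      using p2[of k] by simp
    moreover have "real (Suc k) * 1 \<le> real (Suc k) * ?P"
      using p2[of k] by (intro mult_left_mono) auto
    ultimately show ?thesis
      by (metis mult_1_right order_trans)
  qed
  moreover obtain k where "8 * pi * B < real k"
    using reals_Archimedean2 by blast
  ultimately show False
    by (smt (verit) of_nat_Suc)
qed

theorem proposition5:
  fixes r :: real and p q :: "nat \<Rightarrow> int" and x :: "real \<Rightarrow> real ^ 3"
  assumes "liouville_number r"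
    and "\<And>m. m \<ge> 1 \<Longrightarrow> p m \<ge> 2"
    and "\<And>m. m \<ge> 1 \<Longrightarrow> q m \<ge> 1"
    and "\<And>m. m \<ge> 1 \<Longrightarrow> 0 < \<bar>r * of_int (p m) - of_int (q m)\<bar>"
    and "\<And>m. m \<ge> 1 \<Longrightarrow>
           \<bar>r * of_int (p m) - of_int (q m)\<bar> < of_int (p m) powi (- int m)"
    and "\<And>m. m \<ge> 2 \<Longrightarrow>
           of_int (p m) powi (- int m) < \<bar>r * of_int (p (m - 1)) - of_int (q (m - 1))\<bar>"
    and "solves_ivp (h r p q) 0 x"
  shows "\<not> bounded ((\<lambda>t. x t $ 3) ` {0..}) \<and> \<not> strong_rotation_vector_exists x"
proof (intro conjI notI)
  note unbounded = third_component_drift_unbounded[OF assms(2,4,5,7)]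
  show False if "bounded ((\<lambda>t. x t $ 3) ` {0..})"
  proof -
    from that obtain B where "\<And>t. t \<ge> 0 \<Longrightarrow> \<bar>x t $ 3\<bar> \<le> B"
      unfolding bounded_iff by auto
    then show False
      \<comment> \<open>Plain boundedness is the case of zero slope.\<close>
      using unbounded[where \<rho> = 0 and B = B] by force
  qed
  show False if "strong_rotation_vector_exists x"
  proof -
    have x0: "x 0 = 0"
      using assms(7) by (simp add: solves_ivp_def)
    from that obtain \<rho> B where B: "\<And>t. t \<ge> 0 \<Longrightarrow> norm (x t - t *\<^sub>R \<rho>) \<le> B"
      unfolding strong_rotation_vector_exists_def bdd_above_def by (auto simp: x0)
    \<comment> \<open>A bounded deviation of the vector bounds that of its third coordinate, with
      slope \<open>\<rho> $ 3\<close>.\<close>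
    have "\<bar>x t $ 3 - \<rho> $ 3 * t\<bar> \<le> B" if "t \<ge> 0" for t
      using component_le_norm_cart[of "x t - t *\<^sub>R \<rho>" 3] B[OF that] by (simp add: mult.commute)
    then show False
      using unbounded[where \<rho> = "\<rho> $ 3" and B = B] by force
  qed
qed

end
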